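(* Let $r>0$ and suppose $f$ is a complex-valued function that is analytic and nonvanishing in a neighborhood of the closed disc $\{z\in\mathbb{C}:|z|\le r\}$. Then there exist complex numbers $\xi_j,\eta_j$ with $|\xi_j|=|\eta_j|=1$, a constant $A\in\mathbb{C}$, and positive integers $\nu(j)$ ($j=1,2,3,\dots$) such that $$f(z)=A\prod_{j=1}^\infty (1+\xi_j z^j)^{\nu(j)}(1+\eta_j z^j)$$ for $|z|<\min\{r,1\}$, with the convergence of the product (i.e. of the partial products over $1\le j\le J$ as $J\to\infty$) uniform on $|z|<\min\{r,1-\delta\}$ for any $\delta>0$. In particular, for any $\delta>0$, $f$ can be approximated uniformly on $|z|<\min\{r,1-\delta\}$ by polynomials having all their roots on the unit circle $\{z:|z|=1\}$.
   Context: In the infinite product, the $j$-th factor is $(1+\xi_j z^j)^{\nu(j)}(1+\eta_j z^j)$. *)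

theory Defs
  imports "HOL-Complex_Analysis.Complex_Analysis" "HOL-Computational_Algebra.Polynomial"
begin

definition prod_factor ::
    "(nat \<Rightarrow> complex) \<Rightarrow> (nat \<Rightarrow> complex) \<Rightarrow> (nat \<Rightarrow> nat) \<Rightarrow> nat \<Rightarrow> complex \<Rightarrow> complex"
  where "prod_factor \<xi> \<eta> \<nu> j z = (1 + \<xi> j * z ^ j) ^ \<nu> j * (1 + \<eta> j * z ^ j)"

text \<open>
  The product runs over \<open>j \<ge> 1\<close>, whereas the library's infinite products start at index 0;
  hence the shift by \<^const>\<open>Suc\<close>. The values of the three sequences at 0 are irrelevant.
\<close>

definition inf_prod ::
    "(nat \<Rightarrow> complex) \<Rightarrow> (nat \<Rightarrow> complex) \<Rightarrow> (nat \<Rightarrow> nat) \<Rightarrow> complex \<Rightarrow> complex"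
  where "inf_prod \<xi> \<eta> \<nu> z = (\<Prod>j. prod_factor \<xi> \<eta> \<nu> (Suc j) z)"

end

theory Submission imports Defs begin

text \<open>
  Choose a logarithm \<open>g\<close> of \<open>f\<close> and expand \<open>g(z) - g(0) = \<Sum>\<^sub>k c\<^sub>k z\<^sup>k\<close>. Taking logarithms of the
  factors, the product formula amounts to one equation for each exponent \<open>j\<close>, namely
  \<open>\<nu>\<^sub>j \<xi>\<^sub>j + \<eta>\<^sub>j = w\<^sub>j\<close>, where \<open>w\<^sub>j\<close> is \<open>c\<^sub>j\<close> minus the contributions of the factors
  with index a proper divisor of \<open>j\<close>. Every complex \<open>w\<close> has the form \<open>n x + y\<close> with
  \<open>\<bar>x\<bar> = \<bar>y\<bar> = 1\<close> and \<open>1 \<le> n \<le> \<bar>w\<bar> + 1\<close>, so the equations can be solved recursively. Proper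
  divisors of \<open>j\<close> are at most \<open>j/2\<close>, so the feedback does not increase the exponential growth
  rate: \<open>c\<^sub>j = O(Q\<^sup>j)\<close> with \<open>Q > 1\<close> implies \<open>\<nu>\<^sub>j = O(Q\<^sup>j)\<close>, which makes the double series
  of logarithms absolutely convergent wherever \<open>Q \<bar>z\<bar> < 1\<close> and \<open>\<bar>z\<bar> < 1\<close>.
\<close>

section \<open>Complex numbers as sums of a multiple of one unimodular number and another\<close>

lemma unit_combination_exists:
  fixes w :: complex
  shows "\<exists>n x y. n > 0 \<and> norm x = 1 \<and> norm y = 1 \<and> of_nat n * x + y = w \<and> real n \<le> norm w + 1"
proof (cases "w = 0")
  case True
  then show ?thesis
    by (intro exI[of _ "1::nat"] exI[of _ "1::complex"] exI[of _ "-1::complex"]) auto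
next
  case False
  \<comment> \<open>After rotating \<open>w\<close> to \<open>t > 0\<close>, this is a triangle with sides \<open>n\<close>, \<open>1\<close> and \<open>t\<close>,
    and \<open>a\<close> is the cosine of the angle between the first and the last.\<close>
  define t where "t = norm w"
  define n where "n = Suc (nat \<lfloor>t\<rfloor>)"
  have t: "t > 0" using False by (simp add: t_def)
  have n1: "real n \<ge> 1" by (simp add: n_def)
  have nt: "t < n" "n \<le> t + 1" unfolding n_def using t by linarith+
  define a where "a = (t\<^sup>2 + n\<^sup>2 - 1) / (2 * t * n)"
  have a_mult: "2 * t * n * a = t\<^sup>2 + n\<^sup>2 - 1" using t n1 by (simp add: a_def)
  have "1 \<le> (real n)\<^sup>2" using n1 by (simp add: power2_eq_square mult_ge1_I)
  then have "t\<^sup>2 + (real n)\<^sup>2 - 1 \<ge> 0" using zero_le_power2[of t] by linarith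
  then have a0: "a \<ge> 0" using t by (simp add: a_def)
  \<comment> \<open>The triangle inequality \<open>\<bar>n - t\<bar> \<le> 1\<close> holds because
    \<open>n\<close> exceeds \<open>t\<close> by at most 1. It is what bounds the prospective cosine
    \<open>a\<close> by 1.\<close>
  have "(real n - t)\<^sup>2 \<le> 1" using nt by (intro power_le_one) auto
  then have "t\<^sup>2 + n\<^sup>2 - 1 \<le> 2 * t * n" by (simp add: power2_eq_square algebra_simps)
  then have a1: "a \<le> 1" using t n1 by (simp add: a_def divide_le_eq)
  define b where "b = sqrt (1 - a\<^sup>2)"
  have ab: "a\<^sup>2 + b\<^sup>2 = 1"
    using a0 a1 power_le_one[of a 2] by (simp add: b_def)
  define u where "u = w / of_real t"
  have u: "norm u = 1" "w = of_real t * u" using False by (auto simp: u_def t_def norm_divide)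
  \<comment> \<open>Law of cosines: the vector leading from \<open>n * (a + i b)\<close> to
    \<open>t\<close> has length 1, so it can serve as the rotated \<open>y\<close>.\<close>
  have "(t - n * a)\<^sup>2 + (n * b)\<^sup>2 = t\<^sup>2 - 2 * t * n * a + n\<^sup>2 * (a\<^sup>2 + b\<^sup>2)"
    by (simp add: power2_eq_square algebra_simps)
  also have "\<dots> = 1" unfolding ab a_mult by simp
  finally have "norm (Complex (t - n * a) (- (n * b))) = 1" by (simp add: complex_norm)
  moreover have "norm (Complex a b) = 1" using ab by (simp add: complex_norm)
  moreover have "of_nat n * Complex a b + Complex (t - n * a) (- (n * b)) = of_real t"
    by (simp add: complex_eq_iff)
  then have "of_nat n * (u * Complex a b) + u * Complex (t - n * a) (- (n * b)) = w"
    unfolding u(2) by (metis (no_types, lifting) distrib_left mult.commute mult.left_commute)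
  ultimately show ?thesis
    using u(1) nt n1 unfolding t_def[symmetric]
    by (intro exI[of _ n] exI[of _ "u * Complex a b"] exI[of _ "u * Complex (t - n * a) (- (n * b))"])
       (auto simp: norm_mult)
qed

section \<open>Logarithms of the factors and their Taylor coefficients\<close>

text \<open>The argument \<open>w\<close> stands for \<open>z ^ j\<close>, so that one function
  serves all indices \<open>j\<close>.\<close>

definition factor_log :: "nat \<Rightarrow> complex \<Rightarrow> complex \<Rightarrow> complex \<Rightarrow> complex" where
  "factor_log n x y w = of_nat n * Ln (1 + x * w) + Ln (1 + y * w)"

text \<open>The coefficient of \<open>w ^ m\<close> in the Taylor series of
  \<open>factor_log n x y w\<close>. At \<open>m = 0\<close> division by zero yields 0, which is the
  correct constant term.\<close>

definition log_coeff :: "nat \<Rightarrow> complex \<Rightarrow> complex \<Rightarrow> nat \<Rightarrow> complex" where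
  "log_coeff n x y m = (-1) ^ Suc m / of_nat m * (of_nat n * x ^ m + y ^ m)"

lemma log_coeff_0 [simp]: "log_coeff n x y 0 = 0"
  by (simp add: log_coeff_def)

lemma log_coeff_1 [simp]: "log_coeff n x y (Suc 0) = of_nat n * x + y"
  by (simp add: log_coeff_def)

lemma norm_log_coeff_le:
  assumes "norm x = 1" "norm y = 1"
  shows "norm (log_coeff n x y m) \<le> real n + 1"
proof (cases "m = 0")
  case False
  have "norm (log_coeff n x y m) = norm (of_nat n * x ^ m + y ^ m) / m"
    by (simp add: log_coeff_def norm_mult norm_divide norm_power)
  also have "\<dots> \<le> norm (of_nat n * x ^ m + y ^ m)"
    using False by (simp add: divide_le_eq mult_left_le mult_ge1_I mult_le_cancel_left1)
  also have "\<dots> \<le> real n + 1"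
    using assms by (intro norm_triangle_le) (simp add: norm_mult norm_power)
  finally show ?thesis .
qed simp

lemma log_coeff_sums:
  assumes "norm x = 1" "norm y = 1" "norm w < 1"
  shows "(\<lambda>m. log_coeff n x y m * w ^ m) sums factor_log n x y w"
proof -
  have "(\<lambda>m. of_nat n * ((-1) ^ Suc m / of_nat m * (x * w) ^ m)
          + (-1) ^ Suc m / of_nat m * (y * w) ^ m) sums factor_log n x y w"
    unfolding factor_log_def using assms
    by (intro sums_add sums_mult Ln_series) (auto simp: norm_mult)
  then show ?thesis
    by (simp add: log_coeff_def power_mult_distrib algebra_simps)
qed

lemma one_plus_unit_mult_nonzero:
  fixes x w :: complex
  assumes "norm x = 1" "norm w < 1"
  shows "1 + x * w \<noteq> 0"
proof
  assume "1 + x * w = 0"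
  then have "norm (x * w) = norm (- 1 :: complex)" by (metis add.inverse_unique add.commute)
  then show False using assms by (simp add: norm_mult)
qed

lemma exp_factor_log:
  assumes "norm x = 1" "norm y = 1" "norm w < 1"
  shows "exp (factor_log n x y w) = (1 + x * w) ^ n * (1 + y * w)"
  using assms by (simp add: factor_log_def exp_add exp_of_nat_mult one_plus_unit_mult_nonzero)

section \<open>Recursive choice of the parameters\<close>

text \<open>In the sum over divisors the term \<open>d = j\<close> is
  \<open>\<nu> j * \<xi> j + \<eta> j\<close>, while all others involve smaller indices only.
  Well-founded recursion therefore reduces each equation to \<open>unit_combination_exists\<close>,
  whose bound on \<open>n\<close> gives the growth estimate.\<close>

lemma factor_sequences_exist:
  fixes c :: "nat \<Rightarrow> complex"
  obtains \<xi> \<eta> :: "nat \<Rightarrow> complex" and \<nu> :: "nat \<Rightarrow> nat"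
  where "\<And>j. norm (\<xi> j) = 1" "\<And>j. norm (\<eta> j) = 1" "\<And>j. \<nu> j > 0"
    "\<And>j. j \<ge> 1 \<Longrightarrow> (\<Sum>d | d dvd j. log_coeff (\<nu> d) (\<xi> d) (\<eta> d) (j div d)) = c j"
    "\<And>j. j \<ge> 1 \<Longrightarrow> real (\<nu> j) + 1 \<le> norm (c j) + 2 + (\<Sum>d=1..j div 2. real (\<nu> d) + 1)"
proof -
  define g where "g = (\<lambda>(n, x, y). log_coeff n x y)"
  \<comment> \<open>The clause \<open>d < j\<close> leaves the proper divisors for
    \<open>j \<ge> 1\<close> and makes \<open>D 0\<close> empty, so the recursion also covers index
    0.\<close>
  define D where "D j = {d. d dvd j \<and> d < j}" for j :: nat
  define P where "P f j p \<longleftrightarrow> (case p of (n, x, y) \<Rightarrow>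
      let w = c j - (\<Sum>d\<in>D j. g (f d) (j div d)) in
      n > 0 \<and> norm x = 1 \<and> norm y = 1 \<and> of_nat n * x + y = w \<and> real n \<le> norm w + 1)"
    for f :: "nat \<Rightarrow> nat \<times> complex \<times> complex" and j p
  \<comment> \<open>The choice principle needs that \<open>P f j\<close> depends only on the values
    of \<open>f\<close> below \<open>j\<close>, and that a suitable triple always exists.\<close>
  have "\<exists>f. \<forall>j. P f j (f j)"
  proof (rule dependent_wellorder_choice)
    fix p :: "nat \<times> complex \<times> complex" and f h :: "nat \<Rightarrow> nat \<times> complex \<times> complex" and j :: nat
    assume *: "\<And>d. d < j \<Longrightarrow> f d = h d"
    have "(\<Sum>d\<in>D j. g (f d) (j div d)) = (\<Sum>d\<in>D j. g (h d) (j div d))"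
      by (intro sum.cong) (auto simp: D_def *)
    then show "P f j p = P h j p" by (simp add: P_def)
  next
    fix f :: "nat \<Rightarrow> nat \<times> complex \<times> complex" and j :: nat
    show "\<exists>p. P f j p"
      using unit_combination_exists[of "c j - (\<Sum>d\<in>D j. g (f d) (j div d))"]
      by (auto simp: P_def Let_def)
  qed
  then obtain f where f: "\<And>j. P f j (f j)" by blast
  define \<nu> \<xi> \<eta> where defs: "\<nu> j = fst (f j)" "\<xi> j = fst (snd (f j))" "\<eta> j = snd (snd (f j))" for j
  define L where "L d = log_coeff (\<nu> d) (\<xi> d) (\<eta> d)" for d
  define w where "w j = c j - (\<Sum>d\<in>D j. L d (j div d))" for j
  have gf: "g (f d) = L d" for d by (simp add: g_def L_def defs split: prod.split)
  have *: "\<nu> j > 0 \<and> norm (\<xi> j) = 1 \<and> norm (\<eta> j) = 1 \<and> of_nat (\<nu> j) * \<xi> j + \<eta> j = w j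
             \<and> real (\<nu> j) \<le> norm (w j) + 1" for j
    using f[of j] unfolding P_def gf w_def by (simp add: defs Let_def split: prod.splits)
  show ?thesis
  proof (rule that[of \<xi> \<eta> \<nu>])
    fix j :: nat assume j: "j \<ge> 1"
    have D: "{d. d dvd j} = insert j (D j)" using j by (auto simp: D_def dest: dvd_imp_le)
    have fin: "finite (D j)" by (simp add: D_def)
    have "(\<Sum>d | d dvd j. L d (j div d)) = L j 1 + (\<Sum>d\<in>D j. L d (j div d))"
      unfolding D using j fin by (subst sum.insert) (auto simp: D_def)
    also have "\<dots> = c j" using *[of j] by (simp add: L_def[of j] w_def)
    finally show "(\<Sum>d | d dvd j. log_coeff (\<nu> d) (\<xi> d) (\<eta> d) (j div d)) = c j"
      by (simp add: L_def)
    have sub: "D j \<subseteq> {1..j div 2}"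
    proof
      fix d assume "d \<in> D j"
      then obtain k where k: "j = d * k" "d < j" by (auto simp: D_def)
      then have "k \<ge> 2" using j by (cases k rule: nat.exhaust) (auto simp: Suc_le_eq)
      then have "2 * d \<le> j" using k by (metis mult.commute mult_le_mono1)
      then show "d \<in> {1..j div 2}" using k j by (cases d) auto
    qed
    have "norm (w j) \<le> norm (c j) + norm (\<Sum>d\<in>D j. L d (j div d))"
      unfolding w_def by (rule norm_triangle_ineq4)
    also have "norm (\<Sum>d\<in>D j. L d (j div d)) \<le> (\<Sum>d\<in>D j. real (\<nu> d) + 1)"
      unfolding L_def using * by (intro sum_norm_le norm_log_coeff_le) auto
    also have "\<dots> \<le> (\<Sum>d=1..j div 2. real (\<nu> d) + 1)"
      using sub by (intro sum_mono2) auto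
    finally show "real (\<nu> j) + 1 \<le> norm (c j) + 2 + (\<Sum>d=1..j div 2. real (\<nu> d) + 1)"
      using *[of j] by linarith
  qed (use * in auto)
qed

section \<open>Exponential growth under a halving recurrence\<close>

text \<open>Induction: the sum has \<open>h = j div 2\<close> terms, each at most
  \<open>K * Q ^ h\<close>, and \<open>2 * h \<le> Q ^ h\<close> once \<open>h\<close> is large. The
  sum thus uses at most half of \<open>K * Q ^ j\<close>, and the other half absorbs
  \<open>b j\<close>.\<close>

lemma halving_recurrence_bound:
  fixes v b :: "nat \<Rightarrow> real"
  assumes Q: "Q > 1" and b: "\<And>j. j \<ge> 1 \<Longrightarrow> b j \<le> C * Q ^ j"
    and v: "\<And>j. j \<ge> 1 \<Longrightarrow> v j \<le> b j + (\<Sum>d=1..j div 2. v d)"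
  obtains K where "K \<ge> 0" "\<And>j. j \<ge> 1 \<Longrightarrow> v j \<le> K * Q ^ j"
proof -
  have "(\<lambda>n. of_nat n * (1 / Q) ^ n) \<longlonglongrightarrow> (0::real)"
    using Q by (intro powser_times_n_limit_0) simp
  then have "eventually (\<lambda>n. of_nat n * (1 / Q) ^ n < 1 / 2) sequentially"
    by (rule order_tendstoD) simp
  then obtain N where N: "\<And>n. n \<ge> N \<Longrightarrow> of_nat n * (1 / Q) ^ n < 1 / 2"
    by (auto simp: eventually_at_top_linorder)
  have half: "2 * real n \<le> Q ^ n" if "n \<ge> N" for n
    using N[OF that] Q by (simp add: field_simps)
  \<comment> \<open>The first entry ensures \<open>C \<le> K / 2\<close>; the second covers the
    finitely many indices to which \<open>half\<close> does not apply.\<close>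
  define K where "K = max (2 * \<bar>C\<bar>) (\<Sum>j<2*N. \<bar>v j\<bar>)"
  have K: "K \<ge> 0" "C \<le> K / 2" by (auto simp: K_def)
  have small: "\<bar>v j\<bar> \<le> K" if "j < 2 * N" for j
    using member_le_sum[of j "{..<2*N}" "\<lambda>j. \<bar>v j\<bar>"] that by (auto simp: K_def)
  have "v j \<le> K * Q ^ j" if "j \<ge> 1" for j
    using that
  proof (induction j rule: less_induct)
    case (less j)
    show ?case
    proof (cases "j < 2 * N")
      case True
      have "K \<le> K * Q ^ j" using K Q by (intro mult_right_mono[of 1, simplified mult_1] mult_le_cancel_left1[THEN iffD2]) auto
      then show ?thesis using small[OF True] by linarith
    next
      case False
      define h where "h = j div 2"
      have h: "h \<ge> N" "h < j" "2 * h \<le> j" using False less.prems by (auto simp: h_def)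
      have "(\<Sum>d=1..h. v d) \<le> (\<Sum>d=1..h. K * Q ^ h)"
      proof (rule sum_mono)
        fix d assume d: "d \<in> {1..h}"
        then have "v d \<le> K * Q ^ d" using h by (intro less.IH) auto
        also have "\<dots> \<le> K * Q ^ h"
          using d Q K by (intro mult_left_mono power_increasing) auto
        finally show "v d \<le> K * Q ^ h" .
      qed
      also have "\<dots> = K / 2 * (2 * real h * Q ^ h)" by simp
      also have "\<dots> \<le> K / 2 * (Q ^ h * Q ^ h)"
        using half[OF h(1)] Q K by (intro mult_left_mono mult_right_mono) auto
      also have "\<dots> \<le> K / 2 * Q ^ j"
        using h Q K unfolding power_add[symmetric] by (intro mult_left_mono power_increasing) auto
      finally have "(\<Sum>d=1..h. v d) \<le> K / 2 * Q ^ j" .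
      moreover have "b j \<le> K / 2 * Q ^ j"
        using b[OF less.prems] K Q by (smt (verit) mult_right_mono zero_le_power)
      ultimately show ?thesis using v[OF less.prems] by (simp add: h_def)
    qed
  qed
  with K show ?thesis using that by blast
qed

section \<open>The double series of logarithms\<close>

text \<open>Since \<open>j * Suc m \<ge> j + m\<close> for \<open>j \<ge> 1\<close>, the exponent
  can be lowered to a sum. This separates the indices and leaves a product of two geometric terms as
  majorant.\<close>

lemma norm_log_coeff_term_le:
  assumes unit: "norm x = 1" "norm y = 1" and j: "j \<ge> 1"
    and bound: "real n + 1 \<le> K * Q ^ j" and K: "K \<ge> 0" "Q > 0"
    and \<rho>: "\<rho> < 1" "norm z \<le> \<rho>"
  shows "norm (log_coeff n x y (Suc m) * z ^ (j * Suc m)) \<le> K * (Q * \<rho>) ^ j * \<rho> ^ m"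
proof -
  have \<rho>0: "\<rho> \<ge> 0" using \<rho>(2) norm_ge_zero[of z] by linarith
  have "norm z ^ (j * Suc m) \<le> norm z ^ (j + m)"
    using \<rho> j by (intro power_decreasing) auto
  also have "\<dots> \<le> \<rho> ^ (j + m)" using \<rho> by (intro power_mono) auto
  finally have "norm (log_coeff n x y (Suc m)) * norm z ^ (j * Suc m)
      \<le> (K * Q ^ j) * \<rho> ^ (j + m)"
    using order_trans[OF norm_log_coeff_le[OF unit] bound] K \<rho>0 by (intro mult_mono) auto
  then show ?thesis by (simp add: norm_mult norm_power power_add power_mult_distrib mult_ac)
qed

text \<open>The double series with terms \<open>a d m * z ^ (d * m)\<close> is summed in two ways:
  fixing \<open>d\<close> gives the logarithm of one factor, fixing \<open>k = d * m\<close> gives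
  \<open>c k * z ^ k\<close>. Absolute convergence makes the totals agree. The second claim is a
  majorant independent of \<open>z\<close>.\<close>

lemma factor_log_resummation:
  fixes \<xi> \<eta> c :: "nat \<Rightarrow> complex" and \<nu> :: "nat \<Rightarrow> nat"
  assumes unit: "\<And>j. norm (\<xi> j) = 1" "\<And>j. norm (\<eta> j) = 1"
    and bound: "\<And>j. j \<ge> 1 \<Longrightarrow> real (\<nu> j) + 1 \<le> K * Q ^ j" and K: "K \<ge> 0" "Q > 0"
    and \<rho>: "\<rho> < 1" "Q * \<rho> < 1" "norm z \<le> \<rho>"
    and c: "\<And>j. j \<ge> 1 \<Longrightarrow> (\<Sum>d | d dvd j. log_coeff (\<nu> d) (\<xi> d) (\<eta> d) (j div d)) = c j"
    and S: "(\<lambda>k. c (Suc k) * z ^ Suc k) sums S"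
  shows "(\<lambda>j. factor_log (\<nu> (Suc j)) (\<xi> (Suc j)) (\<eta> (Suc j)) (z ^ Suc j)) sums S"
    and "norm (factor_log (\<nu> (Suc j)) (\<xi> (Suc j)) (\<eta> (Suc j)) (z ^ Suc j))
           \<le> K * (Q * \<rho>) ^ Suc j / (1 - \<rho>)"
proof -
  have \<rho>0: "\<rho> \<ge> 0" using \<rho>(3) norm_ge_zero[of z] by linarith
  define a where "a d = log_coeff (\<nu> d) (\<xi> d) (\<eta> d)" for d
  define F where "F = (\<lambda>(i, n). a (Suc i) (Suc n) * z ^ (Suc i * Suc n))"
  define B where "B = (\<lambda>(i::nat, n::nat). K * (Q * \<rho>) ^ Suc i * \<rho> ^ n)"
  define l where "l i = factor_log (\<nu> (Suc i)) (\<xi> (Suc i)) (\<eta> (Suc i)) (z ^ Suc i)" for i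
  define M where "M i = K * (Q * \<rho>) ^ Suc i / (1 - \<rho>)" for i :: nat
  have FB: "norm (F (i, n)) \<le> B (i, n)" for i n
    using norm_log_coeff_term_le[OF unit(1)[of "Suc i"] unit(2)[of "Suc i"] _ bound[of "Suc i"] K \<rho>(1,3), of n]
    by (simp add: F_def B_def a_def)
  have B_sums: "(\<lambda>n. B (i, n)) sums M i" for i
    using sums_mult[OF geometric_sums[of \<rho>], of "K * (Q * \<rho>) ^ Suc i"] \<rho> \<rho>0
    by (simp add: B_def M_def)
  have B_nonneg: "B p \<ge> 0" for p using K \<rho>0 by (auto simp: B_def split: prod.split)
  have B_has_sum: "((\<lambda>n. B (i, n)) has_sum M i) UNIV" for i
    using B_sums B_nonneg by (intro sums_nonneg_imp_has_sum)
  have "summable M"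
    unfolding M_def using \<rho> \<rho>0 K
    by (intro summable_divide summable_mult summable_Suc_iff[THEN iffD2] summable_geometric) auto
  moreover have "M i \<ge> 0" for i using \<rho> \<rho>0 K by (auto simp: M_def)
  ultimately have "M summable_on UNIV" by (subst summable_on_UNIV_nonneg_real_iff)
  then have "B summable_on (SIGMA i:UNIV. UNIV)"
    using B_has_sum B_nonneg by (intro summable_on_SigmaI[where g = M]) auto
  then have F_abs: "(\<lambda>p. norm (F p)) summable_on (SIGMA i:UNIV. UNIV)"
    by (rule summable_on_comparison_test) (use FB in auto)
  have wlt: "norm (z ^ Suc i) < 1" for i
    using \<rho> by (auto simp: norm_power power_less_one_iff simp del: power_Suc)
  have F_row_sums: "(\<lambda>n. F (i, n)) sums l i" for i
  proof -
    define h where "h = (\<lambda>m. a (Suc i) m * (z ^ Suc i) ^ m)"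
    \<comment> \<open>Here \<open>h 0 = 0\<close>; it is written out to match the index shift that
      drops the constant term.\<close>
    have "h sums (l i + h 0)"
      using log_coeff_sums[OF unit(1)[of "Suc i"] unit(2)[of "Suc i"] wlt[of i], of "\<nu> (Suc i)"]
      by (simp add: h_def a_def l_def)
    then have "(\<lambda>n. h (Suc n)) sums l i" by (simp only: sums_Suc_iff)
    moreover have "h (Suc n) = F (i, n)" for n
      unfolding h_def F_def prod.case power_mult ..
    ultimately show ?thesis by simp
  qed
  have F_row_summable: "summable (\<lambda>n. norm (F (i, n)))" for i
    by (rule summable_comparison_test'[OF sums_summable[OF B_sums[of i]]]) (use FB in auto)
  have F_row: "((\<lambda>n. F (i, n)) has_sum l i) UNIV" for i
    by (intro norm_summable_imp_has_sum F_row_summable F_row_sums)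
  have "norm (l j) \<le> M j"
    using suminf_le[OF FB F_row_summable sums_summable[OF B_sums], of j]
      summable_norm[OF F_row_summable[of j]] sums_unique[OF F_row_sums[of j]] sums_unique[OF B_sums[of j]]
    by simp
  then show "norm (factor_log (\<nu> (Suc j)) (\<xi> (Suc j)) (\<eta> (Suc j)) (z ^ Suc j))
           \<le> K * (Q * \<rho>) ^ Suc j / (1 - \<rho>)" by (simp add: l_def M_def)
  obtain T where T: "(F has_sum T) (SIGMA i:UNIV. UNIV)"
    using abs_summable_summable[OF F_abs] by (auto simp: summable_on_def)
  have "(l has_sum T) UNIV" by (rule has_sum_SigmaD[OF T]) (rule F_row)
  then have l: "l sums T" by (rule has_sum_imp_sums)
  \<comment> \<open>The same terms as in \<open>F\<close>, regrouped by the total exponent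
    \<open>k = Suc i * Suc n\<close> and the divisor \<open>d = Suc i\<close>.\<close>
  define G where "G = (\<lambda>(k, d). a d (k div d) * z ^ k)"
  have "(G has_sum T) (SIGMA k:{1..}. {d. d dvd k})"
  proof -
    have "(F has_sum T) (SIGMA i:UNIV. UNIV) \<longleftrightarrow> ?thesis"
      by (rule has_sum_reindex_bij_witness[of _ "\<lambda>(k, d). (d - 1, k div d - 1)" "\<lambda>(i, n). (Suc i * Suc n, Suc i)"])
         (auto simp: F_def G_def dvd_def simp del: mult_Suc mult_Suc_right power_Suc)
    then show ?thesis using T by simp
  qed
  then have "((\<lambda>k. c k * z ^ k) has_sum T) {1..}"
  proof (rule has_sum_SigmaD)
    fix k :: nat assume k: "k \<in> {1..}"
    then have "finite {d. d dvd k}" by simp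
    then have "((\<lambda>d. G (k, d)) has_sum (\<Sum>d | d dvd k. G (k, d))) {d. d dvd k}"
      by (rule has_sum_finite)
    also have "(\<Sum>d | d dvd k. G (k, d)) = c k * z ^ k"
      using c[of k] k by (simp add: G_def a_def sum_distrib_right[symmetric])
    finally show "((\<lambda>d. G (k, d)) has_sum c k * z ^ k) {d. d dvd k}" .
  qed
  moreover have "bij_betw Suc UNIV {1..}"
    by (rule bij_betw_byWitness[of _ "\<lambda>k. k - 1"]) auto
  ultimately have "((\<lambda>k. c (Suc k) * z ^ Suc k) has_sum T) UNIV"
    by (simp only: has_sum_reindex_bij_betw[of Suc UNIV "{1..}" "\<lambda>k. c k * z ^ k"])
  then have "S = T" using S by (blast dest: has_sum_imp_sums intro: sums_unique2)
  then show "(\<lambda>j. factor_log (\<nu> (Suc j)) (\<xi> (Suc j)) (\<eta> (Suc j)) (z ^ Suc j)) sums S"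
    using l unfolding l_def by simp
qed

section \<open>Uniform convergence of the partial products\<close>

text \<open>The sums of logarithms converge uniformly by the Weierstrass M-test. They stay in a
  fixed compact disc, on which \<open>exp\<close> is uniformly continuous, so exponentiating
  preserves uniform convergence.\<close>

lemma prod_factor_uniform_limit:
  fixes \<xi> \<eta> c :: "nat \<Rightarrow> complex" and \<nu> :: "nat \<Rightarrow> nat" and L :: "complex \<Rightarrow> complex"
  assumes unit: "\<And>j. norm (\<xi> j) = 1" "\<And>j. norm (\<eta> j) = 1"
    and bound: "\<And>j. j \<ge> 1 \<Longrightarrow> real (\<nu> j) + 1 \<le> K * Q ^ j" and K: "K \<ge> 0" "Q > 0"
    and \<rho>: "0 \<le> \<rho>" "\<rho> < 1" "Q * \<rho> < 1" and X: "X \<subseteq> cball 0 \<rho>"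
    and c: "\<And>j. j \<ge> 1 \<Longrightarrow> (\<Sum>d | d dvd j. log_coeff (\<nu> d) (\<xi> d) (\<eta> d) (j div d)) = c j"
    and L: "\<And>z. z \<in> X \<Longrightarrow> (\<lambda>k. c (Suc k) * z ^ Suc k) sums L z"
  shows "uniform_limit X (\<lambda>J z. \<Prod>j=1..J. prod_factor \<xi> \<eta> \<nu> j z) (\<lambda>z. exp (L z)) sequentially"
proof -
  define l where "l j z = factor_log (\<nu> (Suc j)) (\<xi> (Suc j)) (\<eta> (Suc j)) (z ^ Suc j)" for j z
  define M where "M j = K * (Q * \<rho>) ^ Suc j / (1 - \<rho>)" for j :: nat
  have zX: "norm z \<le> \<rho>" if "z \<in> X" for z using that X by auto
  have lM: "norm (l j z) \<le> M j" if "z \<in> X" for j z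
    unfolding l_def M_def using factor_log_resummation(2)[OF unit bound K \<rho>(2,3) zX[OF that] c L[OF that]] .
  have lL: "(\<lambda>j. l j z) sums L z" if "z \<in> X" for z
    unfolding l_def using factor_log_resummation(1)[OF unit bound K \<rho>(2,3) zX[OF that] c L[OF that]] .
  have sM: "summable M"
    unfolding M_def using \<rho> K
    by (intro summable_divide summable_mult summable_Suc_iff[THEN iffD2] summable_geometric) auto
  have M0: "M j \<ge> 0" for j using \<rho> K by (simp add: M_def)
  have "uniformly_convergent_on X (\<lambda>J z. \<Sum>j<J. l j z)"
    by (rule Weierstrass_m_test'[OF lM sM])
  then have "uniformly_convergent_on X (\<lambda>J z. exp (\<Sum>j<J. l j z))"
  proof (rule uniformly_convergent_on_compose_uniformly_continuous_on)
    show "uniformly_continuous_on (cball 0 (suminf M)) (exp :: complex \<Rightarrow> complex)"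
      by (intro compact_uniformly_continuous continuous_intros compact_cball)
    have "norm (\<Sum>j<J. l j z) \<le> suminf M" if "z \<in> X" for J z
      using sum_norm_le[of "{..<J}" "\<lambda>j. l j z" M] lM[OF that] sum_le_suminf[OF sM, of "{..<J}"] M0
      by force
    then show "eventually (\<lambda>J. \<forall>z\<in>X. (\<Sum>j<J. l j z) \<in> cball 0 (suminf M)) sequentially" by simp
  qed simp
  then obtain E where E: "uniform_limit X (\<lambda>J z. exp (\<Sum>j<J. l j z)) E sequentially"
    by (auto simp: uniformly_convergent_on_def)
  \<comment> \<open>The uniform limit is so far anonymous; the pointwise limit identifies
    it.\<close>
  have EL: "E z = exp (L z)" if "z \<in> X" for z
  proof -
    have "(\<lambda>J. exp (\<Sum>j<J. l j z)) \<longlonglongrightarrow> exp (L z)"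
      using lL[OF that] unfolding sums_def by (rule tendsto_exp)
    then show ?thesis using tendsto_uniform_limitI[OF E that] LIMSEQ_unique by blast
  qed
  have prod: "exp (\<Sum>j<J. l j z) = (\<Prod>j=1..J. prod_factor \<xi> \<eta> \<nu> j z)" if "z \<in> X" for J z
  proof -
    have "norm (z ^ Suc j) < 1" for j
      using zX[OF that] \<rho> by (auto simp: norm_power power_less_one_iff simp del: power_Suc)
    then have "exp (l j z) = prod_factor \<xi> \<eta> \<nu> (Suc j) z" for j
      unfolding l_def prod_factor_def by (intro exp_factor_log unit)
    then show ?thesis by (simp add: exp_sum prod.atLeast1_atMost_eq)
  qed
  show ?thesis
    using E by (rule uniform_limit_cong'[THEN iffD1, rotated -1]) (simp_all add: prod EL)
qed

section \<open>Auxiliary facts on discs, coefficients and zeros\<close>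

lemma cball_subset_open_enlarge:
  fixes a :: "'a :: euclidean_space"
  assumes "open U" "cball a r \<subseteq> U" "r > 0"
  obtains R where "R > r" "ball a R \<subseteq> U"
proof -
  obtain e where e: "e > 0" "(\<Union>x\<in>cball a r. cball x e) \<subseteq> U"
    using compact_subset_open_imp_cball_epsilon_subset[OF compact_cball assms(1,2)] by blast
  have "ball a (r + e) \<subseteq> U"
  proof
    fix z assume z: "z \<in> ball a (r + e)"
    show "z \<in> U"
    proof (cases "dist a z \<le> r")
      case False
      \<comment> \<open>The point \<open>x\<close> below is the radial projection of
        \<open>z\<close> onto the sphere of radius \<open>r\<close>, at distance
        \<open>dist a z - r < e\<close> from \<open>z\<close>.\<close>
      define t where "t = r / dist a z"
      have t: "0 \<le> t" "t \<le> 1" "t * dist a z = r" using False assms by (auto simp: t_def divide_le_eq)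
      define x where "x = a + t *\<^sub>R (z - a)"
      have "norm (x - a) = r" using t by (simp add: x_def dist_norm norm_minus_commute)
      moreover have "z - x = (1 - t) *\<^sub>R (z - a)" by (simp add: x_def algebra_simps)
      then have "norm (z - x) = dist a z - r"
        using t by (simp add: dist_norm norm_minus_commute left_diff_distrib)
      ultimately have "x \<in> cball a r" "z \<in> cball x e"
        using z by (auto simp: dist_norm norm_minus_commute)
      then show ?thesis using e by blast
    qed (use assms in auto)
  qed
  then show ?thesis using that[of "r + e"] e by simp
qed

lemma power_series_coeff_bound:
  fixes c :: "nat \<Rightarrow> complex"
  assumes "summable (\<lambda>k. c k * of_real s ^ k)" "s > 0"
  obtains C where "C \<ge> 0" "\<And>k. norm (c k) \<le> C * (1 / s) ^ k"
proof -
  obtain C where C: "C > 0" "\<And>k. norm (c k * of_real s ^ k) \<le> C"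
    using summable_LIMSEQ_zero[OF assms(1), THEN convergentI, THEN convergent_imp_Bseq]
    by (auto elim: BseqE)
  have "norm (c k) \<le> C * (1 / s) ^ k" for k
    using C(2)[of k] assms(2) by (simp add: norm_mult norm_power power_one_over field_simps)
  then show ?thesis using that[of C] C by simp
qed

lemma prod_factor_poly:
  "\<exists>p. (\<forall>z. poly p z = (\<Prod>j=1..J. prod_factor \<xi> \<eta> \<nu> j z))"
proof -
  define q where "q j = (1 + monom (\<xi> j) j) ^ \<nu> j * (1 + monom (\<eta> j) j)" for j
  have "poly (\<Prod>j=1..J. q j) z = (\<Prod>j=1..J. prod_factor \<xi> \<eta> \<nu> j z)" for z
    by (simp add: poly_prod q_def prod_factor_def poly_monom)
  then show ?thesis by blast
qed

text \<open>Serves twice: it locates the roots of the approximating polynomials, and it shows that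
  no factor vanishes inside the unit disc.\<close>

lemma prod_factor_eq_0_imp_norm:
  assumes "prod_factor \<xi> \<eta> \<nu> j z = 0" "norm (\<xi> j) = 1" "norm (\<eta> j) = 1" "j \<ge> 1"
  shows "norm z = 1"
proof -
  from assms(1) have "1 + \<xi> j * z ^ j = 0 \<or> 1 + \<eta> j * z ^ j = 0"
    by (auto simp: prod_factor_def)
  then have "\<xi> j * z ^ j = - 1 \<or> \<eta> j * z ^ j = - 1"
    by (metis add.inverse_unique)
  then have "norm (\<xi> j * z ^ j) = 1 \<or> norm (\<eta> j * z ^ j) = 1" by auto
  then have "norm z ^ j = 1" using assms by (simp add: norm_mult norm_power)
  then show ?thesis using assms(4) power_eq_1_iff[of "norm z" j] by simp
qed

section \<open>Product formula and polynomial approximation\<close>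

theorem theorem2p1:
  fixes r :: real and f :: "complex \<Rightarrow> complex" and U :: "complex set"
  assumes "r > 0"
    and "open U" and "cball 0 r \<subseteq> U"
    and "f analytic_on U" and "\<forall>z\<in>U. f z \<noteq> 0"
  shows "(\<exists>(\<xi> :: nat \<Rightarrow> complex) (\<eta> :: nat \<Rightarrow> complex) (A :: complex) (\<nu> :: nat \<Rightarrow> nat).
            (\<forall>j\<ge>1. norm (\<xi> j) = 1 \<and> norm (\<eta> j) = 1 \<and> \<nu> j > 0) \<and>
            (\<forall>z. norm z < min r 1 \<longrightarrow>
               convergent_prod (\<lambda>j. prod_factor \<xi> \<eta> \<nu> (Suc j) z) \<and>
               f z = A * inf_prod \<xi> \<eta> \<nu> z) \<and>
            (\<forall>\<delta>>0. uniform_limit {z. norm z < min r (1 - \<delta>)}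
               (\<lambda>J z. \<Prod>j=1..J. prod_factor \<xi> \<eta> \<nu> j z) (inf_prod \<xi> \<eta> \<nu>) sequentially))
       \<and> (\<forall>\<delta>>0. \<forall>\<epsilon>>0. \<exists>p :: complex poly.
            (\<forall>z. poly p z = 0 \<longrightarrow> norm z = 1) \<and>
            (\<forall>z. norm z < min r (1 - \<delta>) \<longrightarrow> norm (f z - poly p z) < \<epsilon>))"
proof -
  obtain R where R: "R > r" "ball 0 R \<subseteq> U"
    using cball_subset_open_enlarge[OF assms(2,3,1)] by blast
  have "f holomorphic_on ball 0 R"
    using assms(4) R(2) analytic_imp_holomorphic holomorphic_on_subset by blast
  moreover have "f z \<noteq> 0" if "z \<in> ball 0 R" for z using that R(2) assms(5) by blast
  moreover have "0 \<in> ball (0::complex) R" using R assms(1) by simp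
  ultimately obtain g where g: "g holomorphic_on ball 0 R" "\<And>z. z \<in> ball 0 R \<Longrightarrow> exp (g z) = f z"
    using holomorphic_logarithm_exists[OF convex_ball open_ball] by metis
  define c where "c k = (deriv ^^ k) g 0 / fact k" for k
  have g_sums: "(\<lambda>k. c k * z ^ k) sums g z" if "norm z < R" for z
    using holomorphic_power_series[OF g(1), of z] that by (simp add: c_def)
  have c0: "c 0 = g 0" by (simp add: c_def)
  have tail_sums: "(\<lambda>k. c (Suc k) * z ^ Suc k) sums (g z - g 0)" if "norm z < R" for z
    using g_sums[OF that] unfolding sums_Suc_iff[of "\<lambda>k. c k * z ^ k"] by (simp add: c0)
  \<comment> \<open>The sequences depend on \<open>c\<close> alone and are fixed before
    \<open>\<delta>\<close>, so one product serves every disc; only the constants \<open>s\<close>,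
    \<open>C\<close> and \<open>K\<close> below vary with \<open>\<delta>\<close>.\<close>
  obtain \<xi> \<eta> :: "nat \<Rightarrow> complex" and \<nu> :: "nat \<Rightarrow> nat" where
      unit: "\<And>j. norm (\<xi> j) = 1" "\<And>j. norm (\<eta> j) = 1" and \<nu>: "\<And>j. \<nu> j > 0"
    and coeffs: "\<And>j. j \<ge> 1 \<Longrightarrow> (\<Sum>d | d dvd j. log_coeff (\<nu> d) (\<xi> d) (\<eta> d) (j div d)) = c j"
    and growth: "\<And>j. j \<ge> 1 \<Longrightarrow> real (\<nu> j) + 1 \<le> norm (c j) + 2 + (\<Sum>d=1..j div 2. real (\<nu> d) + 1)"
    using factor_sequences_exist[of c] by blast
  define P where "P J z = (\<Prod>j=1..J. prod_factor \<xi> \<eta> \<nu> j z)" for J z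
  have unif: "uniform_limit {z. norm z < min r (1 - \<delta>)} P (\<lambda>z. exp (g z - g 0)) sequentially"
    if \<delta>: "\<delta> > 0" for \<delta>
  proof (cases "min r (1 - \<delta>) > 0")
    case False
    then have empty: "{z :: complex. norm z < min r (1 - \<delta>)} = {}"
      by (auto simp: not_less intro: order_trans[OF _ norm_ge_zero])
    show ?thesis unfolding empty by (simp add: uniform_limit_iff)
  next
    case True
    define \<rho> where "\<rho> = min r (1 - \<delta>)"
    have "\<rho> < min R 1" using R \<delta> by (auto simp: \<rho>_def)
    \<comment> \<open>The growth rate will be \<open>Q = 1 / s\<close>: \<open>s < R\<close> makes
      the series converge at \<open>s\<close>, \<open>s < 1\<close> gives \<open>Q > 1\<close>, and
      \<open>\<rho> < s\<close> gives \<open>Q * \<rho> < 1\<close>.\<close>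
    then obtain s where s: "\<rho> < s" "s < min R 1" using dense by blast
    have \<rho>: "0 < \<rho>" "\<rho> < 1" using True \<delta> by (auto simp: \<rho>_def)
    have "summable (\<lambda>k. c k * of_real s ^ k)"
      using g_sums[of "of_real s"] s \<rho> by (auto dest: sums_summable)
    then obtain C where C: "C \<ge> 0" "\<And>k. norm (c k) \<le> C * (1 / s) ^ k"
      using power_series_coeff_bound s \<rho> by (metis order.strict_trans)
    have Q: "1 / s > 1" "1 / s * \<rho> < 1" using s \<rho> by auto
    have "norm (c k) + 2 \<le> (C + 2) * (1 / s) ^ k" for k
      using C(2)[of k] one_le_power[of "1 / s" k] Q(1) unfolding distrib_right by linarith
    then obtain K where K: "K \<ge> 0" "\<And>j. j \<ge> 1 \<Longrightarrow> real (\<nu> j) + 1 \<le> K * (1 / s) ^ j"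
      using halving_recurrence_bound[OF Q(1), of "\<lambda>j. norm (c j) + 2" "C + 2" "\<lambda>j. real (\<nu> j) + 1"] growth
      by blast
    show ?thesis
      unfolding P_def
    proof (rule prod_factor_uniform_limit[OF unit K(2) K(1)])
      show "(\<lambda>k. c (Suc k) * z ^ Suc k) sums (g z - g 0)" if "z \<in> {z. norm z < min r (1 - \<delta>)}" for z
        using that R by (intro tail_sums) auto
    qed (use s \<rho> Q coeffs in \<open>auto simp: \<rho>_def\<close>)
  qed
  have conv: "convergent_prod (\<lambda>j. prod_factor \<xi> \<eta> \<nu> (Suc j) z) \<and> inf_prod \<xi> \<eta> \<nu> z = exp (g z - g 0)"
    if z: "norm z < min r 1" for z
  proof -
    \<comment> \<open>With \<open>\<delta> = (1 - norm z) / 2\<close> the point \<open>z\<close>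
      lies in the disc of uniform convergence.\<close>
    have "(\<lambda>J. P J z) \<longlonglongrightarrow> exp (g z - g 0)"
      using z by (intro tendsto_uniform_limitI[OF unif[of "(1 - norm z) / 2"]]) (auto simp: field_simps)
    then have "(\<lambda>n. P (Suc n) z) \<longlonglongrightarrow> exp (g z - g 0)" by (rule LIMSEQ_Suc)
    then have lim: "(\<lambda>n. \<Prod>j\<le>n. prod_factor \<xi> \<eta> \<nu> (Suc j) z) \<longlonglongrightarrow> exp (g z - g 0)"
      unfolding P_def One_nat_def prod.atLeast_Suc_atMost_Suc_shift
      by (simp add: atLeast0AtMost comp_def)
    \<comment> \<open>With nonzero factors, \<open>convergent_prod\<close> amounts to a nonzero
      limit of the partial products, and this limit is an exponential.\<close>
    have "prod_factor \<xi> \<eta> \<nu> (Suc j) z \<noteq> 0" for j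
      using prod_factor_eq_0_imp_norm[of \<xi> \<eta> \<nu> "Suc j" z] unit z by auto
    then have "convergent_prod (\<lambda>j. prod_factor \<xi> \<eta> \<nu> (Suc j) z)"
      using lim by (subst convergent_prod_iff_nz_lim) auto
    moreover from this have "inf_prod \<xi> \<eta> \<nu> z = exp (g z - g 0)"
      unfolding inf_prod_def using convergent_prod_LIMSEQ lim LIMSEQ_unique by blast
    ultimately show ?thesis by blast
  qed
  have f_eq: "f z = exp (g 0) * exp (g z - g 0)" if "norm z < R" for z
    using g(2)[of z] that by (simp add: exp_diff)
  have approx: "\<exists>p :: complex poly. (\<forall>z. poly p z = 0 \<longrightarrow> norm z = 1) \<and>
      (\<forall>z. norm z < min r (1 - \<delta>) \<longrightarrow> norm (f z - poly p z) < \<epsilon>)"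
    if \<delta>: "\<delta> > 0" and \<epsilon>: "\<epsilon> > 0" for \<delta> \<epsilon>
  proof -
    \<comment> \<open>The approximant will be \<open>A * P J\<close> with
      \<open>A = exp (g 0)\<close>, hence the tolerance is divided by the modulus of
      \<open>A\<close>. As \<open>A\<close> is nonzero, scaling adds no roots.\<close>
    have "eventually (\<lambda>J. \<forall>z\<in>{z. norm z < min r (1 - \<delta>)}.
        dist (P J z) (exp (g z - g 0)) < \<epsilon> / norm (exp (g 0))) sequentially"
      using \<epsilon> by (intro uniform_limitD[OF unif[OF \<delta>]]) simp
    then obtain J where J: "\<And>z. norm z < min r (1 - \<delta>) \<Longrightarrow>
        dist (P J z) (exp (g z - g 0)) < \<epsilon> / norm (exp (g 0))"
      by (auto simp: eventually_at_top_linorder)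
    obtain p where p: "\<And>z. poly p z = P J z" using prod_factor_poly unfolding P_def by metis
    show ?thesis
    proof (intro exI[of _ "smult (exp (g 0)) p"] conjI allI impI)
      fix z assume "poly (smult (exp (g 0)) p) z = 0"
      then obtain j where "j \<in> {1..J}" "prod_factor \<xi> \<eta> \<nu> j z = 0"
        by (auto simp: p P_def)
      then show "norm z = 1" using prod_factor_eq_0_imp_norm unit by auto
    next
      fix z :: complex assume z: "norm z < min r (1 - \<delta>)"
      have "f z - poly (smult (exp (g 0)) p) z = exp (g 0) * (exp (g z - g 0) - P J z)"
        using z R by (simp add: f_eq p right_diff_distrib)
      then have "norm (f z - poly (smult (exp (g 0)) p) z)
          = norm (exp (g 0)) * dist (P J z) (exp (g z - g 0))"
        by (simp only: norm_mult dist_norm norm_minus_commute)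
      also have "\<dots> < \<epsilon>" using J[OF z] by (simp add: pos_less_divide_eq mult.commute)
      finally show "norm (f z - poly (smult (exp (g 0)) p) z) < \<epsilon>" .
    qed
  qed
  show ?thesis
  proof (rule conjI, rule exI[of _ \<xi>], rule exI[of _ \<eta>], rule exI[of _ "exp (g 0)"],
      rule exI[of _ \<nu>], intro conjI allI impI)
    show "norm (\<xi> j) = 1" "norm (\<eta> j) = 1" "\<nu> j > 0" for j by (fact unit \<nu>)+
    show "convergent_prod (\<lambda>j. prod_factor \<xi> \<eta> \<nu> (Suc j) z)"
      and "f z = exp (g 0) * inf_prod \<xi> \<eta> \<nu> z" if "norm z < min r 1" for z
      using conv[OF that] f_eq[of z] that R by auto
  next
    fix \<delta> :: real assume "\<delta> > 0"
    then show "uniform_limit {z. norm z < min r (1 - \<delta>)}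
        (\<lambda>J z. \<Prod>j=1..J. prod_factor \<xi> \<eta> \<nu> j z) (inf_prod \<xi> \<eta> \<nu>) sequentially"
      using unif[of \<delta>] conv unfolding P_def
      by (subst uniform_limit_cong'[where g = "\<lambda>J z. \<Prod>j=1..J. prod_factor \<xi> \<eta> \<nu> j z" and i = "\<lambda>z. exp (g z - g 0)"]) auto
  qed (use approx in blast)
qed

end
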